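(* Let $a,b$ be integers with $2\le a\le b-2$ and let $\rho$ be a root of the polynomial $x^3-(a+b)x^2+abx-1$. Let $\alpha=-v+(bw+1)\rho-w\rho^2$, where $v,w$ are integers with $0\le v\le b-a-1$ and $va\le w\le (v+1)a-1$. Then \[ \min_{\delta\in\mathbb Z[\rho]^{\vee,+}}\mathrm{Tr}(\alpha\delta)=\min\{b-a-v+1,\; w-av+1\}. \]
   Context: The field $K=\mathbb Q(\rho)$ is a totally real cubic field and $\mathbb Z[\rho]$ is an order in it. An element of $K$ is totally positive if all its images under the embeddings $K\to\mathbb R$ are positive. $\mathrm{Tr}$ is the trace from $K$ to $\mathbb Q$. The codifferent is $\mathbb Z[\rho]^\vee=\{\delta\in K:\mathrm{Tr}(\alpha\delta)\in\mathbb Z\text{ for all }\alpha\in\mathbb Z[\rho]\}$, and $\mathbb Z[\rho]^{\vee,+}$ is the set of its totally positive elements. *)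

theory Defs
  imports "HOL-Analysis.Analysis" "HOL-Computational_Algebra.Polynomial"
begin

text \<open>Number fields are subfields of the complex numbers. The field \<open>\<rat>(\<rho>)\<close>:\<close>

definition rat_adjoin :: "complex \<Rightarrow> complex set" where
  "rat_adjoin \<rho> = {poly (map_poly of_rat p) \<rho> / poly (map_poly of_rat q) \<rho> |
     p q. poly (map_poly of_rat q) \<rho> \<noteq> 0}"

text \<open>The ring \<open>\<int>[\<rho>]\<close>:\<close>

definition int_adjoin :: "complex \<Rightarrow> complex set" where
  "int_adjoin \<rho> = range (\<lambda>p. poly (map_poly of_int p) \<rho>)"

text \<open>
  Field embeddings of \<open>K\<close> into \<open>'b\<close>. Extensionality makes distinct elements of this set
  correspond to distinct maps on \<open>K\<close>, so that sums over the set count each embedding once.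
\<close>

definition embeddings :: "complex set \<Rightarrow> (complex \<Rightarrow> 'b::field) set" where
  "embeddings K = {\<sigma> \<in> extensional K. \<sigma> 1 = 1 \<and>
     (\<forall>x\<in>K. \<forall>y\<in>K. \<sigma> (x + y) = \<sigma> x + \<sigma> y \<and> \<sigma> (x * y) = \<sigma> x * \<sigma> y)}"

definition totally_positive :: "complex set \<Rightarrow> complex \<Rightarrow> bool" where
  "totally_positive K x \<longleftrightarrow> (\<forall>\<sigma>\<in>(embeddings K :: (complex \<Rightarrow> real) set). \<sigma> x > 0)"

text \<open>
  The trace from a number field \<open>K\<close> to \<open>\<rat>\<close>: the sum of the images under all embeddings
  \<open>K \<rightarrow> \<complex>\<close>. This sum is rational, and the definite description reads it as an element of \<open>\<rat>\<close>.
\<close>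

definition field_trace :: "complex set \<Rightarrow> complex \<Rightarrow> rat" where
  "field_trace K x =
     (THE t. of_rat t = (\<Sum>\<sigma>\<in>(embeddings K :: (complex \<Rightarrow> complex) set). \<sigma> x))"

definition codifferent :: "complex set \<Rightarrow> complex set \<Rightarrow> complex set" where
  "codifferent K R = {\<delta> \<in> K. \<forall>\<alpha>\<in>R. field_trace K (\<alpha> * \<delta>) \<in> \<int>}"

definition codifferent_pos :: "complex set \<Rightarrow> complex set \<Rightarrow> complex set" where
  "codifferent_pos K R = {\<delta> \<in> codifferent K R. totally_positive K \<delta>}"

definition is_minimum :: "'a::linorder set \<Rightarrow> 'a \<Rightarrow> bool" where
  "is_minimum S m \<longleftrightarrow> m \<in> S \<and> (\<forall>s\<in>S. m \<le> s)"

end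

theory Submission
  imports Defs "HOL-Computational_Algebra.Polynomial_Factorial" "HOL-Computational_Algebra.Field_as_Ring"
begin

text \<open>
  The polynomial has roots \<open>0 < r\<^sub>1 < 1\<close>, \<open>a - 1 < r\<^sub>2 < a\<close> and \<open>b < r\<^sub>3\<close>, and \<open>\<rho>\<close>, \<open>\<rho> - a\<close>, \<open>\<rho> - b\<close> are
  units with product 1. Put \<open>\<eta> = 1 / (a - \<rho>) = \<rho> (b - \<rho>)\<close> and \<open>u = w - va\<close>, so that
  \<open>\<alpha> = \<rho> + u \<eta> + v \<rho>\<eta>\<close> with \<open>0 \<le> u < a\<close>. For totally positive \<open>\<delta>\<close> in the codifferent let
  \<open>p = Tr(\<eta>\<delta>)\<close> and \<open>q = Tr(\<rho>\<eta>\<delta>)\<close>, which are integers with \<open>a p - q = Tr(\<delta>) \<ge> 1\<close>.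
  If \<open>q \<ge> 0\<close>, then \<open>p \<ge> 1\<close> and \<open>Tr(\<alpha>\<delta>) \<ge> 1 + u\<close>. If \<open>q < 0\<close>, then the contribution of the place
  \<open>r\<^sub>3\<close>, the only one at which \<open>\<eta>\<close> is negative, is large enough to force \<open>Tr(\<alpha>\<delta>) > b - a - v\<close>.
  Both bounds are attained, at elements \<open>g(\<rho>) / f'(\<rho>)\<close> with \<open>g\<close> of degree 2.
\<close>

subsection \<open>Embeddings of a simple extension of the rationals\<close>

text \<open>The target field stays polymorphic, so that one rational polynomial can be evaluated at
  the complex number \<rho> and at its real conjugates.\<close>

abbreviation rat_eval :: "rat poly \<Rightarrow> 'a::field_char_0 \<Rightarrow> 'a" where
  "rat_eval p x \<equiv> poly (map_poly of_rat p) x"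

lemma rat_eval_pCons [simp]: "rat_eval (pCons c p) x = of_rat c + x * rat_eval p x"
  by (simp add: map_poly_pCons)

lemma rat_eval_add [simp]: "rat_eval (p + q) x = rat_eval p x + rat_eval q x"
proof (induction p arbitrary: q)
  case (pCons c p)
  then show ?case
    by (cases q) (simp add: of_rat_add algebra_simps)
qed simp

lemma rat_eval_smult [simp]: "rat_eval (smult c p) x = of_rat c * rat_eval p x"
  by (induction p) (simp_all add: of_rat_mult algebra_simps)

lemma rat_eval_mult [simp]: "rat_eval (p * q) x = rat_eval p x * rat_eval q x"
  by (induction p) (simp_all add: algebra_simps)

lemma rat_eval_diff [simp]: "rat_eval (p - q) x = rat_eval p x - rat_eval q x"
  using rat_eval_add[of "p - q" q x] by simp

lemma rat_eval_map_of_int: "rat_eval (map_poly of_int p) x = poly (map_poly of_int p) x"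
  by (simp add: map_poly_map_poly o_def)

lemma rat_eval_dvd: "f dvd p \<Longrightarrow> rat_eval f x = 0 \<Longrightarrow> rat_eval p x = 0"
  by (auto elim!: dvdE)

text \<open>An irreducible \<open>f\<close> not dividing \<open>p\<close> is coprime to it.
  Evaluating a Bezout identity at the root \<open>x\<close> removes the multiple of \<open>f\<close>
  and leaves an inverse.\<close>

lemma rat_eval_inverse:
  assumes f: "irreducible f" "rat_eval f x = 0" and p: "\<not> f dvd p"
  obtains q where "rat_eval p x * rat_eval q x = 1"
proof -
  have "prime_elem f"
    using f(1) by (simp add: prime_elem_iff_irreducible)
  then have "coprime f p"
    using p by (rule prime_elem_imp_coprime)
  then have "fst (bezout_coefficients f p) * f + snd (bezout_coefficients f p) * p = 1"
    by (simp only: bezout_coefficients_fst_snd coprime_iff_gcd_eq_1)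
  then have "rat_eval (fst (bezout_coefficients f p) * f + snd (bezout_coefficients f p) * p) x = 1"
    by simp
  then show thesis
    using f(2) that[of "snd (bezout_coefficients f p)"] by (simp add: mult.commute)
qed

lemma rat_eval_eq_0_iff_dvd:
  assumes f: "irreducible f" "rat_eval f x = 0"
  shows "rat_eval p x = 0 \<longleftrightarrow> f dvd p"
  using rat_eval_inverse[OF f, of p] rat_eval_dvd[OF _ f(2), of p]
  by (metis mult_zero_left zero_neq_one)

text \<open>Conjugation principle: a rational polynomial identity at one root of \<open>f\<close>
  says that \<open>f\<close> divides the difference, so it carries over to every other root, even
  one in a different field.\<close>

lemma rat_eval_cong_root:
  assumes f: "irreducible f" "rat_eval f x = 0" "rat_eval f y = 0"
    and "rat_eval p x = rat_eval q x"
  shows "rat_eval p y = rat_eval q y"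
proof -
  have "rat_eval (p - q) x = 0" using assms(4) by simp
  then have "f dvd p - q" using rat_eval_eq_0_iff_dvd[OF f(1,2)] by blast
  then have "rat_eval (p - q) y = 0" using f(3) by (rule rat_eval_dvd)
  then show ?thesis by simp
qed

lemma rat_eval_in_rat_adjoin: "rat_eval p \<rho> \<in> rat_adjoin \<rho>"
  unfolding rat_adjoin_def by (intro CollectI exI[of _ p] exI[of _ 1]) simp

text \<open>A denominator that does not vanish at \<rho> is not divisible by \<open>f\<close>, so
  its inverse is again a polynomial value.\<close>

lemma rat_adjoin_eq_range:
  assumes f: "irreducible f" "rat_eval f \<rho> = 0"
  shows "rat_adjoin \<rho> = range (\<lambda>p. rat_eval p \<rho>)"
proof (intro equalityI subsetI)
  fix x assume "x \<in> rat_adjoin \<rho>"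
  then obtain p q where x: "x = rat_eval p \<rho> / rat_eval q \<rho>" and q: "rat_eval q \<rho> \<noteq> 0"
    by (auto simp: rat_adjoin_def)
  obtain r where "rat_eval q \<rho> * rat_eval r \<rho> = 1"
    using q rat_eval_inverse[OF f] rat_eval_eq_0_iff_dvd[OF f] by blast
  then have "inverse (rat_eval q \<rho>) = rat_eval r \<rho>"
    by (rule inverse_unique)
  then have "x = rat_eval (p * r) \<rho>"
    using x by (simp add: divide_inverse)
  then show "x \<in> range (\<lambda>p. rat_eval p \<rho>)" by blast
qed (use rat_eval_in_rat_adjoin in auto)

text \<open>Additivity, multiplicativity and \<open>\<sigma> 1 = 1\<close> force \<sigma> to fix
  naturals, integers and then fractions; the image of \<rho> determines the rest.\<close>

lemma embedding_rat_eval: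
  fixes \<sigma> :: "complex \<Rightarrow> 'b::field_char_0"
  assumes \<sigma>: "\<sigma> \<in> embeddings (rat_adjoin \<rho>)"
  shows "\<sigma> (rat_eval p \<rho>) = rat_eval p (\<sigma> \<rho>)"
proof -
  let ?K = "rat_adjoin \<rho>"
  have add: "\<sigma> (x + y) = \<sigma> x + \<sigma> y" and mult: "\<sigma> (x * y) = \<sigma> x * \<sigma> y"
    if "x \<in> ?K" "y \<in> ?K" for x y
    using \<sigma> that by (auto simp: embeddings_def)
  have one: "\<sigma> 1 = 1" using \<sigma> by (simp add: embeddings_def)
  have const: "of_rat c \<in> ?K" for c
    using rat_eval_in_rat_adjoin[of "[:c:]"] by simp
  have zero: "\<sigma> 0 = 0" using add[of 0 0] const[of 0] by simp
  have nat: "\<sigma> (of_nat n) = of_nat n" for n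
  proof (induction n)
    case (Suc n)
    then show ?case
      using add[of 1 "of_nat n"] one const[of 1] const[of "of_nat n"] by simp
  qed (simp add: zero)
  have int: "\<sigma> (of_int n) = of_int n" for n
  proof (cases n rule: int_cases2)
    case (nonneg m)
    then show ?thesis by (simp add: nat)
  next
    case (nonpos m)
    have "\<sigma> (of_int n) + \<sigma> (of_nat m) = 0"
      using add[of "of_int n" "of_nat m"] const[of "of_int n"] const[of "of_nat m"] nonpos zero
      by (simp del: of_int_minus of_rat_minus) simp
    then show ?thesis using nonpos nat[of m] by (simp add: add_eq_0_iff)
  qed
  have rat: "\<sigma> (of_rat c) = of_rat c" for c
  proof (cases c)
    case (Fract m n)
    have c: "of_int n * of_rat c = (of_int m :: complex)" "of_int n * of_rat c = (of_int m :: 'b)"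
      using Fract by (simp_all add: Fract_of_int_quotient of_rat_divide)
    have "\<sigma> (of_int n) * \<sigma> (of_rat c) = \<sigma> (of_int m)"
      using mult[of "of_int n" "of_rat c"] const[of "of_int n"] const[of c] c(1) by simp
    then have "of_int n * \<sigma> (of_rat c) = (of_int n * of_rat c :: 'b)"
      using c(2) by (simp add: int)
    then show ?thesis using Fract by simp
  qed
  have rho: "\<rho> \<in> ?K" using rat_eval_in_rat_adjoin[of "[:0, 1:]" \<rho>] by simp
  show ?thesis
  proof (induction p)
    case (pCons c p)
    have "\<rho> * rat_eval p \<rho> \<in> ?K"
      using rat_eval_in_rat_adjoin[of "pCons 0 p" \<rho>] by simp
    then show ?case
      using pCons.IH rho by (simp add: add mult const rat rat_eval_in_rat_adjoin)
  qed (simp add: zero)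
qed

lemma bij_betw_embeddings_roots:
  fixes \<rho> :: complex
  assumes f: "irreducible f" "rat_eval f \<rho> = 0"
  shows "bij_betw (\<lambda>\<sigma>. \<sigma> \<rho>) (embeddings (rat_adjoin \<rho>))
    {c :: 'b::field_char_0. rat_eval f c = 0}"
proof -
  let ?K = "rat_adjoin \<rho>"
  let ?E = "embeddings ?K :: (complex \<Rightarrow> 'b) set"
  note K = rat_adjoin_eq_range[OF f]
  \<comment> \<open>Any polynomial representing \<open>x\<close> may be chosen, since by conjugation
    its value at a root \<open>c\<close> does not depend on the choice. Restricting to the field
    makes the map extensional.\<close>
  define emb where "emb c = (\<lambda>x\<in>?K. rat_eval (SOME p. x = rat_eval p \<rho>) c)" for c :: 'b
  have emb: "emb c (rat_eval p \<rho>) = rat_eval p c" if "rat_eval f c = 0" for c p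
  proof -
    have "rat_eval p \<rho> = rat_eval (SOME q. rat_eval p \<rho> = rat_eval q \<rho>) \<rho>"
      by (rule someI) (rule refl)
    then have "rat_eval p c = rat_eval (SOME q. rat_eval p \<rho> = rat_eval q \<rho>) c"
      by (rule rat_eval_cong_root[OF f that])
    then show ?thesis
      by (simp add: emb_def rat_eval_in_rat_adjoin)
  qed
  have "inj_on (\<lambda>\<sigma>. \<sigma> \<rho>) ?E"
  proof (rule inj_onI)
    fix \<sigma> \<tau> :: "complex \<Rightarrow> 'b"
    assume st: "\<sigma> \<in> ?E" "\<tau> \<in> ?E" "\<sigma> \<rho> = \<tau> \<rho>"
    show "\<sigma> = \<tau>"
    proof (rule extensionalityI[of _ ?K])
      show "\<sigma> \<in> extensional ?K" "\<tau> \<in> extensional ?K"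
        using st by (auto simp: embeddings_def)
      fix x assume "x \<in> ?K"
      then show "\<sigma> x = \<tau> x"
        using st by (auto simp: K embedding_rat_eval)
    qed
  qed
  moreover have "(\<lambda>\<sigma>. \<sigma> \<rho>) ` ?E = {c. rat_eval f c = 0}"
  proof (intro equalityI subsetI)
    fix c assume "c \<in> (\<lambda>\<sigma>. \<sigma> \<rho>) ` ?E"
    then obtain \<sigma> where \<sigma>: "\<sigma> \<in> ?E" "c = \<sigma> \<rho>" by blast
    \<comment> \<open>Zero is written as the value of the zero polynomial so that the evaluation
      rule for \<sigma> also yields \<open>\<sigma> 0 = 0\<close>.\<close>
    have "rat_eval f c = \<sigma> (rat_eval 0 \<rho>)"
      using embedding_rat_eval[OF \<sigma>(1), of f] f(2) \<sigma>(2) by simp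
    also have "\<dots> = 0" by (subst embedding_rat_eval[OF \<sigma>(1)]) simp
    finally show "c \<in> {c. rat_eval f c = 0}" by simp
  next
    fix c :: 'b assume "c \<in> {c. rat_eval f c = 0}"
    then have c: "rat_eval f c = 0" by simp
    have "emb c 1 = 1" using emb[OF c, of 1] by simp
    moreover have "emb c (x + y) = emb c x + emb c y \<and> emb c (x * y) = emb c x * emb c y"
      if "x \<in> ?K" "y \<in> ?K" for x y
    proof -
      obtain p where [simp]: "x = rat_eval p \<rho>"
        using \<open>x \<in> ?K\<close> unfolding K by blast
      obtain q where [simp]: "y = rat_eval q \<rho>"
        using \<open>y \<in> ?K\<close> unfolding K by blast
      show ?thesis
        using emb[OF c, of p] emb[OF c, of q] emb[OF c, of "p + q"] emb[OF c, of "p * q"] by simp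
    qed
    ultimately have "emb c \<in> ?E" by (simp add: embeddings_def emb_def)
    moreover have "emb c \<rho> = c" using emb[OF c, of "[:0, 1:]"] by simp
    ultimately show "c \<in> (\<lambda>\<sigma>. \<sigma> \<rho>) ` ?E" by (intro image_eqI[of _ _ "emb c"]) simp_all
  qed
  ultimately show ?thesis by (simp add: bij_betw_def)
qed

lemma sum_embeddings:
  fixes \<rho> :: complex
  assumes f: "irreducible f" "rat_eval f \<rho> = 0"
  shows "(\<Sum>\<sigma>\<in>embeddings (rat_adjoin \<rho>). \<sigma> (rat_eval p \<rho>)) =
    (\<Sum>c | rat_eval f c = 0. rat_eval p (c :: 'b::field_char_0))"
  using sum.reindex_bij_betw[OF bij_betw_embeddings_roots[OF f], of "rat_eval p"]
  by (simp add: embedding_rat_eval)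

lemma totally_positive_rat_eval_iff:
  fixes \<rho> :: complex
  assumes f: "irreducible f" "rat_eval f \<rho> = 0"
  shows "totally_positive (rat_adjoin \<rho>) (rat_eval p \<rho>) \<longleftrightarrow>
    (\<forall>c :: real. rat_eval f c = 0 \<longrightarrow> rat_eval p c > 0)"
proof -
  have roots: "{c :: real. rat_eval f c = 0} = (\<lambda>\<sigma>. \<sigma> \<rho>) ` embeddings (rat_adjoin \<rho>)"
    using bij_betw_embeddings_roots[OF f, where 'b = real] by (simp add: bij_betw_def)
  have "totally_positive (rat_adjoin \<rho>) (rat_eval p \<rho>) \<longleftrightarrow>
      (\<forall>c\<in>{c :: real. rat_eval f c = 0}. rat_eval p c > 0)"
    unfolding roots totally_positive_def by (simp add: embedding_rat_eval)
  then show ?thesis by simp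
qed

text \<open>A proper factorisation of a cubic contains a linear factor, which would supply a
  root.\<close>

lemma irreducible_degree_3_poly:
  fixes f :: "'a::field poly"
  assumes deg: "degree f = 3" and no_root: "\<And>x. poly f x \<noteq> 0"
  shows "irreducible f"
proof (rule irreducibleI)
  show "f \<noteq> 0" using deg by auto
  then show "\<not> f dvd 1" using deg by (simp add: is_unit_iff_degree)
  have no_linear: "degree g \<noteq> 1" if "g dvd f" for g
  proof
    assume "degree g = 1"
    then obtain c d where g: "g = [:c, d:]" "d \<noteq> 0" by (rule degree1_coeffs)
    then have "poly g (- c / d) = 0" by simp
    then show False using that no_root by (metis dvdE mult_eq_0_iff poly_mult)
  qed
  fix g h assume gh: "f = g * h"
  then have "g \<noteq> 0" "h \<noteq> 0" using \<open>f \<noteq> 0\<close> by auto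
  then have "degree g + degree h = 3" using gh deg by (simp add: degree_mult_eq)
  moreover have "degree g \<noteq> 1" "degree h \<noteq> 1" using no_linear gh by auto
  ultimately have "degree g = 0 \<or> degree h = 0" by linarith
  then show "g dvd 1 \<or> h dvd 1"
    using \<open>g \<noteq> 0\<close> \<open>h \<noteq> 0\<close> by (simp add: is_unit_iff_degree)
qed

subsection \<open>The cubic and its roots\<close>

text \<open>The polynomial is monic with integer coefficients, so \<open>x\<close> is an integer
  \<open>n\<close>. The equation \<open>n * ((n - a) * (n - b)) = 1\<close> then makes
  \<open>n\<close> a unit.\<close>

lemma cubic_rational_root:
  fixes a b :: int and x :: rat
  assumes "poly (map_poly of_int [:-1, a * b, - (a + b), 1:]) x = 0"
  shows "x = 1 \<or> x = -1"
proof -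
  have "algebraic_int x"
  proof (rule algebraic_int.intros)
    show "poly (map_poly of_int [:-1, a * b, - (a + b), 1:]) x = 0" by (fact assms)
    show "lead_coeff (map_poly of_int [:-1, a * b, - (a + b), 1:]) = (1 :: rat)"
      by (simp add: map_poly_pCons)
    show "\<forall>i. coeff (map_poly of_int [:-1, a * b, - (a + b), 1:]) i \<in> (\<int> :: rat set)"
      by (auto simp: coeff_map_poly)
  qed
  then have "x \<in> \<int>" by (intro rational_algebraic_int_is_int) (auto simp: Rats_def)
  then obtain n where n: "x = of_int n" by (auto elim: Ints_cases)
  have "of_int (n * ((n - a) * (n - b))) = (of_int 1 :: rat)"
    using assms unfolding n by (simp add: map_poly_pCons algebra_simps)
  then have "n * ((n - a) * (n - b)) = 1" by (simp only: of_int_eq_iff)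
  then have "n dvd 1" by (metis dvd_triv_left)
  then show ?thesis using n by auto
qed

text \<open>Subtracting the equations of two roots and cancelling their difference lowers the
  degree; doing so twice gives the sum of the roots, and back-substitution gives the other two
  relations.\<close>

lemma cubic_Vieta:
  fixes r1 r2 r3 :: "'a::field"
  assumes "r1 \<noteq> r2" "r1 \<noteq> r3" "r2 \<noteq> r3"
    and "\<And>x. x \<in> {r1, r2, r3} \<Longrightarrow> x ^ 3 - s * x\<^sup>2 + t * x - u = 0"
  shows "r1 + r2 + r3 = s" "r1 * r2 + r1 * r3 + r2 * r3 = t" "r1 * r2 * r3 = u"
proof -
  have root: "r1 ^ 3 - s * r1\<^sup>2 + t * r1 - u = 0" "r2 ^ 3 - s * r2\<^sup>2 + t * r2 - u = 0"
    "r3 ^ 3 - s * r3\<^sup>2 + t * r3 - u = 0"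
    using assms(4) by auto
  have "(r1 - r2) * (r1\<^sup>2 + r1 * r2 + r2\<^sup>2 - s * (r1 + r2) + t) = 0"
    "(r1 - r3) * (r1\<^sup>2 + r1 * r3 + r3\<^sup>2 - s * (r1 + r3) + t) = 0"
    using root by algebra+
  then have eq: "r1\<^sup>2 + r1 * r2 + r2\<^sup>2 - s * (r1 + r2) + t = 0"
    "r1\<^sup>2 + r1 * r3 + r3\<^sup>2 - s * (r1 + r3) + t = 0"
    using assms(1,2) by auto
  then have "(r2 - r3) * (r1 + r2 + r3 - s) = 0" by algebra
  then show s: "r1 + r2 + r3 = s" using assms(3) by simp
  show t: "r1 * r2 + r1 * r3 + r2 * r3 = t" using eq(1) unfolding s[symmetric] by algebra
  show "r1 * r2 * r3 = u" using root(1) unfolding s[symmetric] t[symmetric] by algebra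
qed

lemma cubic_factor:
  fixes x :: "'a::comm_ring_1"
  assumes "r1 + r2 + r3 = s" "r1 * r2 + r1 * r3 + r2 * r3 = t" "r1 * r2 * r3 = u"
  shows "x ^ 3 - s * x\<^sup>2 + t * x - u = (x - r1) * (x - r2) * (x - r3)"
  unfolding assms[symmetric] by (simp add: algebra_simps power2_eq_square power3_eq_cube)

lemma of_int_poly_mult: "map_poly of_int (p * q) = map_poly of_int p * (map_poly of_int q :: 'a::comm_ring_1 poly)"
  by (intro poly_eqI) (simp add: coeff_map_poly coeff_mult)

text \<open>Vieta's relations encode that these are the roots: they give the factorisation over
  \<real> and over \<complex> alike. The intervals supply all signs needed later.\<close>

locale cubic_roots =
  fixes a b :: int and r1 r2 r3 :: real
  assumes a: "2 \<le> a" and ab: "a \<le> b - 2"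
    and r1: "0 < r1" "r1 < 1" and r2: "a - 1 < r2" "r2 < a" and r3: "b < r3"
    and e1: "r1 + r2 + r3 = real_of_int a + real_of_int b"
    and e2: "r1 * r2 + r1 * r3 + r2 * r3 = real_of_int a * real_of_int b"
    and e3: "r1 * r2 * r3 = 1"
begin

definition f :: "rat poly" where
  "f = map_poly of_int [:-1, a * b, - (a + b), 1:]"

lemma r_order: "r1 < r2" "r2 < r3" "r1 < r3"
  using r1 r2 r3 a ab by linarith+

lemma root_unit:
  assumes "x \<in> {r1, r2, r3}"
  shows "x * (x - a) * (x - b) = 1"
proof -
  have "(x - r1) * (x - r2) * (x - r3) = 0" using assms by auto
  then show ?thesis
    using e1 e2 e3 by algebra
qed

lemma rat_eval_f: "rat_eval f x = x ^ 3 - (of_int a + of_int b) * x\<^sup>2 + of_int a * of_int b * x - 1"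
  by (simp add: f_def map_poly_pCons of_rat_mult of_rat_diff of_rat_minus
      algebra_simps power2_eq_square power3_eq_cube)

lemma rat_eval_f_real: "rat_eval f x = (x - r1) * (x - r2) * (x - r3)"
  unfolding rat_eval_f by (rule cubic_factor[OF e1 e2 e3])

lemma roots_real: "{x :: real. rat_eval f x = 0} = {r1, r2, r3}"
  by (auto simp: rat_eval_f_real)

lemma rat_eval_f_complex:
  "rat_eval f (x :: complex) = (x - of_real r1) * (x - of_real r2) * (x - of_real r3)"
proof -
  have "complex_of_real r1 + of_real r2 + of_real r3 = of_int a + of_int b"
    "complex_of_real r1 * of_real r2 + of_real r1 * of_real r3 + of_real r2 * of_real r3 = of_int a * of_int b"
    "complex_of_real r1 * of_real r2 * of_real r3 = 1"
    unfolding of_real_add[symmetric] of_real_mult[symmetric] e1 e2 e3 by simp_all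
  then show ?thesis unfolding rat_eval_f by (rule cubic_factor)
qed

lemma roots_complex: "{x :: complex. rat_eval f x = 0} = of_real ` {r1, r2, r3}"
  by (auto simp: rat_eval_f_complex)

lemma irreducible_f: "irreducible f"
proof (rule irreducible_degree_3_poly)
  show "degree f = 3" by (simp add: f_def map_poly_pCons)
  fix x
  show "poly f x \<noteq> 0"
  proof
    assume "poly f x = 0"
    then have "x = 1 \<or> x = -1"
      unfolding f_def by (rule cubic_rational_root)
    moreover have "rat_eval f (of_rat x :: real) = of_rat (poly f x)"
      by (simp add: f_def map_poly_pCons of_rat_add of_rat_mult of_rat_minus of_rat_diff)
    then have "rat_eval f (of_rat x :: real) = 0" using \<open>poly f x = 0\<close> by simp
    then have "(of_rat x :: real) \<in> {r1, r2, r3}" using roots_real by blast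
    \<comment> \<open>Neither 1 nor -1 is possible, because \<open>0 < r1 < 1\<close>,
      \<open>r2 > a - 1 \<ge> 1\<close> and \<open>r3 > b > 1\<close>.\<close>
    ultimately show False
      using r1 r2 r3 a ab by auto
  qed
qed

section \<open>Power sums of the roots and the trace\<close>

text \<open>The cubic equation gives a third-order recurrence with integer coefficients, so the
  first three sums decide. It serves for \<rat> with weights 1 and for \<int> with the reciprocals
  of the derivative at the roots.\<close>

lemma weighted_power_sum_closed:
  fixes c1 c2 c3 :: real
  assumes add: "\<And>x y. x \<in> S \<Longrightarrow> y \<in> S \<Longrightarrow> x + y \<in> S"
    and scale: "\<And>n x. x \<in> S \<Longrightarrow> of_int n * x \<in> S"
    and base: "c1 + c2 + c3 \<in> S" "c1 * r1 + c2 * r2 + c3 * r3 \<in> S"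
      "c1 * r1\<^sup>2 + c2 * r2\<^sup>2 + c3 * r3\<^sup>2 \<in> S"
  shows "c1 * r1 ^ k + c2 * r2 ^ k + c3 * r3 ^ k \<in> S"
proof (induction k rule: less_induct)
  case (less k)
  show ?case
  proof (cases "k < 3")
    case True
    then have "k = 0 \<or> k = 1 \<or> k = 2" by auto
    then show ?thesis using base by auto
  next
    case False
    define j where "j = k - 3"
    have k: "k = j + 3" using False by (simp add: j_def)
    have rec: "x ^ k = of_int (a + b) * x ^ (j + 2) + of_int (- (a * b)) * x ^ (j + 1) + x ^ j"
      if "x \<in> {r1, r2, r3}" for x
    proof -
      have cube: "x ^ 3 = (of_int a + of_int b) * x\<^sup>2 - of_int a * of_int b * x + 1"
        using root_unit[OF that] by algebra
      have "y * x ^ 3 = of_int (a + b) * (y * x\<^sup>2) + of_int (- (a * b)) * (y * x) + y" for y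
        unfolding cube by (simp add: algebra_simps)
      moreover have "x ^ k = x ^ j * x ^ 3" "x ^ (j + 2) = x ^ j * x\<^sup>2" "x ^ (j + 1) = x ^ j * x"
        unfolding k by (simp_all add: power_add power2_eq_square)
      ultimately show ?thesis by (simp only:)
    qed
    define s where "s i = c1 * r1 ^ i + c2 * r2 ^ i + c3 * r3 ^ i" for i
    have "s k = of_int (a + b) * s (j + 2) + of_int (- (a * b)) * s (j + 1) + s j"
      unfolding s_def rec[of r1, simplified] rec[of r2, simplified] rec[of r3, simplified]
      by (simp add: algebra_simps)
    moreover have "s i \<in> S" if "i < k" for i
      using less.IH[OF that] by (simp add: s_def)
    ultimately have "s k \<in> S"
      using k by (auto intro!: add scale simp del: of_int_add of_int_minus of_int_mult)
    then show ?thesis by (simp add: s_def)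
  qed
qed

lemma root_sum_Rats: "rat_eval p r1 + rat_eval p r2 + rat_eval p r3 \<in> \<rat>"
proof -
  have "(r1 + r2 + r3)\<^sup>2 - 2 * (r1 * r2 + r1 * r3 + r2 * r3) \<in> \<rat>"
    unfolding e1 e2 by simp
  also have "(r1 + r2 + r3)\<^sup>2 - 2 * (r1 * r2 + r1 * r3 + r2 * r3) = r1\<^sup>2 + r2\<^sup>2 + r3\<^sup>2"
    by algebra
  finally have power: "r1 ^ k + r2 ^ k + r3 ^ k \<in> \<rat>" for k
    using weighted_power_sum_closed[of \<rat> 1 1 1 k] e1 by simp
  \<comment> \<open>The extra factor \<open>r ^ k\<close> absorbs the shift of the exponent in the
    induction over the coefficients.\<close>
  have "r1 ^ k * rat_eval p r1 + r2 ^ k * rat_eval p r2 + r3 ^ k * rat_eval p r3 \<in> \<rat>" for k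
  proof (induction p arbitrary: k)
    case (pCons c p)
    have "of_rat c * (r1 ^ k + r2 ^ k + r3 ^ k) +
      (r1 ^ Suc k * rat_eval p r1 + r2 ^ Suc k * rat_eval p r2 + r3 ^ Suc k * rat_eval p r3) \<in> \<rat>"
      by (intro Rats_add[OF Rats_mult pCons.IH] power) simp
    then show ?case by (simp add: algebra_simps)
  qed simp
  from this[of 0] show ?thesis by simp
qed

text \<open>Rationality of the sum over the roots justifies the definite description in the trace;
  the complex embeddings are then replaced by the real roots.\<close>

lemma field_trace_rat_eval:
  fixes \<rho> :: complex
  assumes "rat_eval f \<rho> = 0"
  shows "of_rat (field_trace (rat_adjoin \<rho>) (rat_eval p \<rho>)) =
    rat_eval p r1 + rat_eval p r2 + rat_eval p r3"
proof -
  obtain t where t: "of_rat t = rat_eval p r1 + rat_eval p r2 + rat_eval p r3"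
    using root_sum_Rats[of p] by (auto elim!: Rats_cases)
  have [simp]: "complex_of_real (of_rat c) = of_rat c" for c
    by (cases c) (simp add: Fract_of_int_quotient of_rat_divide)
  have of_real: "rat_eval p (complex_of_real x) = of_real (rat_eval p x)" for x
    by (induction p) simp_all
  have "(\<Sum>\<sigma>\<in>embeddings (rat_adjoin \<rho>). \<sigma> (rat_eval p \<rho>)) =
      (\<Sum>c\<in>of_real ` {r1, r2, r3}. rat_eval p (c :: complex))"
    using sum_embeddings[OF irreducible_f assms, of p, where 'b = complex] by (simp only: roots_complex)
  also have "\<dots> = of_real (rat_eval p r1 + rat_eval p r2 + rat_eval p r3)"
    using r_order by (simp add: of_real)
  also have "\<dots> = of_rat t" by (simp only: t[symmetric]) simp
  finally have "field_trace (rat_adjoin \<rho>) (rat_eval p \<rho>) = t"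
    unfolding field_trace_def by (intro the_equality) auto
  then show ?thesis using t by simp
qed


subsection \<open>The codifferent and the minimal trace\<close>

text \<open>The polynomial is the derivative of the cubic, whose value at a simple root is the
  product of the differences to the other two.\<close>

lemma different_eval:
  "rat_eval [:of_int (a * b), of_int (- 2 * (a + b)), 3:] r1 = (r1 - r2) * (r1 - r3)"
  "rat_eval [:of_int (a * b), of_int (- 2 * (a + b)), 3:] r2 = (r2 - r1) * (r2 - r3)"
  "rat_eval [:of_int (a * b), of_int (- 2 * (a + b)), 3:] r3 = (r3 - r1) * (r3 - r2)"
proof -
  have eq: "rat_eval [:of_int (a * b), of_int (- 2 * (a + b)), 3:] x =
      (r1 * r2 + r1 * r3 + r2 * r3) - 2 * (r1 + r2 + r3) * x + 3 * x\<^sup>2" for x :: real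
    unfolding e1 e2
    by (simp add: of_rat_mult of_rat_diff of_rat_minus algebra_simps power2_eq_square)
  show
    "rat_eval [:of_int (a * b), of_int (- 2 * (a + b)), 3:] r1 = (r1 - r2) * (r1 - r3)"
    "rat_eval [:of_int (a * b), of_int (- 2 * (a + b)), 3:] r2 = (r2 - r1) * (r2 - r3)"
    "rat_eval [:of_int (a * b), of_int (- 2 * (a + b)), 3:] r3 = (r3 - r1) * (r3 - r2)"
    unfolding eq by (simp_all add: algebra_simps power2_eq_square)
qed

text \<open>\<open>dual_sum g\<close> is the trace of \<open>g(\<rho>) / f'(\<rho>)\<close>.\<close>

definition dual_sum :: "int poly \<Rightarrow> real" where
  "dual_sum g = poly (map_poly of_int g) r1 / ((r1 - r2) * (r1 - r3)) +
     poly (map_poly of_int g) r2 / ((r2 - r1) * (r2 - r3)) +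
     poly (map_poly of_int g) r3 / ((r3 - r1) * (r3 - r2))"

text \<open>Euler's formula: the expression is the leading coefficient of the Lagrange interpolation
  of the polynomial at the three roots.\<close>

lemma dual_sum_quadratic: "dual_sum [:x, y, z:] = z"
proof -
  have nz: "r1 - r2 \<noteq> 0" "r1 - r3 \<noteq> 0" "r2 - r3 \<noteq> 0" using r_order by auto
  \<comment> \<open>Naming the inverse differences turns the claim into a polynomial identity modulo
    \<open>d\<close>.\<close>
  define d1 d2 d3 where "d1 = inverse (r1 - r2)" "d2 = inverse (r1 - r3)" "d3 = inverse (r2 - r3)"
  have d: "d1 * (r1 - r2) = 1" "d2 * (r1 - r3) = 1" "d3 * (r2 - r3) = 1"
    using nz by (simp_all add: d1_d2_d3_def)
  have "inverse (r2 - r1) = - d1" "inverse (r3 - r1) = - d2" "inverse (r3 - r2) = - d3"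
    by (simp_all add: d1_d2_d3_def flip: inverse_minus_eq)
  then have "dual_sum [:x, y, z:] = (x + r1 * (y + r1 * z)) * (d1 * d2) -
      (x + r2 * (y + r2 * z)) * (d1 * d3) + (x + r3 * (y + r3 * z)) * (d2 * d3)"
    by (simp add: dual_sum_def map_poly_pCons divide_inverse flip: d1_d2_d3_def)
  also have "\<dots> = z" using d by algebra
  finally show ?thesis .
qed

text \<open>The first three weighted power sums are 0, 0 and 1, and the recurrence keeps the later
  ones integral. This places \<open>g(\<rho>) / f'(\<rho>)\<close> in the codifferent.\<close>

lemma dual_sum_Ints: "dual_sum g \<in> \<int>"
proof -
  define c1 c2 c3 where c: "c1 = inverse ((r1 - r2) * (r1 - r3))"
    "c2 = inverse ((r2 - r1) * (r2 - r3))" "c3 = inverse ((r3 - r1) * (r3 - r2))"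
  have eq: "dual_sum g = c1 * poly (map_poly of_int g) r1 + c2 * poly (map_poly of_int g) r2 +
      c3 * poly (map_poly of_int g) r3" for g
    by (simp add: dual_sum_def c divide_inverse mult.commute)
  have "c1 * 1 + c2 * 1 + c3 * 1 = 0" "c1 * r1 + c2 * r2 + c3 * r3 = 0"
    "c1 * r1\<^sup>2 + c2 * r2\<^sup>2 + c3 * r3\<^sup>2 = 1"
    using dual_sum_quadratic[of 1 0 0] dual_sum_quadratic[of 0 1 0] dual_sum_quadratic[of 0 0 1]
    by (simp_all add: eq map_poly_pCons power2_eq_square)
  note moments = this
  have power: "c1 * r1 ^ k + c2 * r2 ^ k + c3 * r3 ^ k \<in> \<int>" for k
    by (rule weighted_power_sum_closed) (use moments in simp_all)
  have "c1 * r1 ^ k * poly (map_poly of_int g) r1 + c2 * r2 ^ k * poly (map_poly of_int g) r2 +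
    c3 * r3 ^ k * poly (map_poly of_int g) r3 \<in> \<int>" for k
  proof (induction g arbitrary: k)
    case (pCons n g)
    have "of_int n * (c1 * r1 ^ k + c2 * r2 ^ k + c3 * r3 ^ k) +
      (c1 * r1 ^ Suc k * poly (map_poly of_int g) r1 + c2 * r2 ^ Suc k * poly (map_poly of_int g) r2 +
       c3 * r3 ^ Suc k * poly (map_poly of_int g) r3) \<in> \<int>"
      by (intro Ints_add[OF Ints_mult pCons.IH] power) simp
    then show ?case by (simp add: map_poly_pCons algebra_simps)
  qed simp
  from this[of 0] show ?thesis by (simp add: eq)
qed

text \<open>The derivative has signs +, -, + at \<open>r1 < r2 < r3\<close>. A polynomial
  \<open>g\<close> with the same signs therefore makes \<open>g(\<rho>) / f'(\<rho>)\<close> totally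
  positive.\<close>

lemma ex_codifferent_pos:
  fixes \<rho> :: complex
  assumes \<rho>: "rat_eval f \<rho> = 0"
    and "poly (map_poly of_int g) r1 > (0 :: real)" "poly (map_poly of_int g) r2 < (0 :: real)"
      "poly (map_poly of_int g) r3 > (0 :: real)"
  obtains \<delta> where "\<delta> \<in> codifferent_pos (rat_adjoin \<rho>) (int_adjoin \<rho>)"
    "\<And>h. of_rat (field_trace (rat_adjoin \<rho>) (poly (map_poly of_int h) \<rho> * \<delta>)) = dual_sum (h * g)"
proof -
  define d where "d = [:of_int (a * b), of_int (- 2 * (a + b)), 3 :: rat:]"
  have d: "rat_eval d r1 = (r1 - r2) * (r1 - r3)" "rat_eval d r2 = (r2 - r1) * (r2 - r3)"
    "rat_eval d r3 = (r3 - r1) * (r3 - r2)"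
    unfolding d_def by (fact different_eval)+
  have roots: "rat_eval f r1 = 0" "rat_eval f r2 = 0" "rat_eval f r3 = 0"
    by (simp_all add: rat_eval_f_real)
  have "rat_eval d \<rho> \<noteq> 0"
  proof
    assume "rat_eval d \<rho> = 0"
    then have "rat_eval d r1 = 0"
      using rat_eval_cong_root[OF irreducible_f \<rho> roots(1), of d 0] by simp
    then show False using r_order d by simp
  qed
  then obtain q where "rat_eval d \<rho> * rat_eval q \<rho> = 1"
    using rat_eval_inverse[OF irreducible_f \<rho>] rat_eval_eq_0_iff_dvd[OF irreducible_f \<rho>] by blast
  \<comment> \<open>Thus \<open>q\<close> represents the reciprocal of the derivative at \<rho> and,
    by conjugation, at the real roots.\<close>
  then have "rat_eval d x * rat_eval q x = 1" if "rat_eval f x = 0" for x :: real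
    using rat_eval_cong_root[OF irreducible_f \<rho> that, of "d * q" 1] by simp
  then have q: "rat_eval q r1 = inverse ((r1 - r2) * (r1 - r3))"
    "rat_eval q r2 = inverse ((r2 - r1) * (r2 - r3))"
    "rat_eval q r3 = inverse ((r3 - r1) * (r3 - r2))"
    unfolding d[symmetric] using roots by (metis inverse_unique)+
  define \<delta> where "\<delta> = rat_eval (map_poly of_int g * q) \<rho>"
  have tr: "of_rat (field_trace (rat_adjoin \<rho>) (poly (map_poly of_int h) \<rho> * \<delta>)) = dual_sum (h * g)"
    for h
  proof -
    have eq: "poly (map_poly of_int h) \<rho> * \<delta> = rat_eval (map_poly of_int h * (map_poly of_int g * q)) \<rho>"
      by (simp only: \<delta>_def rat_eval_mult rat_eval_map_of_int)
    show ?thesis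
      unfolding eq field_trace_rat_eval[OF \<rho>]
      by (simp only: dual_sum_def q rat_eval_mult rat_eval_map_of_int
          of_int_poly_mult poly_mult divide_inverse mult.assoc)
  qed
  have "field_trace (rat_adjoin \<rho>) (\<alpha> * \<delta>) \<in> \<int>" if "\<alpha> \<in> int_adjoin \<rho>" for \<alpha>
  proof -
    obtain h where h: "\<alpha> = poly (map_poly of_int h) \<rho>" using \<open>\<alpha> \<in> int_adjoin \<rho>\<close> unfolding int_adjoin_def by blast
    obtain n where "dual_sum (h * g) = of_int n" using dual_sum_Ints[of "h * g"] by (rule Ints_cases)
    then have "of_rat (field_trace (rat_adjoin \<rho>) (\<alpha> * \<delta>)) = (of_rat (of_int n) :: real)"
      using tr[of h] h by simp
    then show ?thesis by (simp only: of_rat_eq_iff) simp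
  qed
  moreover have "totally_positive (rat_adjoin \<rho>) \<delta>"
  proof -
    have "rat_eval (map_poly of_int g * q) x > 0" if "rat_eval f x = 0" for x :: real
    proof -
      have "inverse ((r1 - r2) * (r1 - r3)) > 0" "inverse ((r2 - r1) * (r2 - r3)) < 0"
        "inverse ((r3 - r1) * (r3 - r2)) > 0"
        using r_order by (simp_all add: mult_neg_neg mult_pos_neg)
      moreover have "x = r1 \<or> x = r2 \<or> x = r3" using that by (auto simp: rat_eval_f_real)
      ultimately show ?thesis
        using assms(2-4) q
        by (elim disjE) (simp_all only: rat_eval_mult rat_eval_map_of_int mult_pos_pos mult_neg_neg)
    qed
    then show ?thesis
      unfolding \<delta>_def totally_positive_rat_eval_iff[OF irreducible_f \<rho>] by blast
  qed
  ultimately have "\<delta> \<in> codifferent_pos (rat_adjoin \<rho>) (int_adjoin \<rho>)"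
    by (simp add: codifferent_pos_def codifferent_def \<delta>_def rat_eval_in_rat_adjoin del: rat_eval_mult)
  then show thesis using tr that by blast
qed

section \<open>The lower bound for the trace\<close>

text \<open>Here \<open>d1\<close>, \<open>d2\<close>, \<open>d3\<close> are the conjugates of
  \<delta>, and \<open>t0\<close>, \<open>t1\<close>, \<open>t2\<close> are the traces of \<delta>,
  \<open>\<rho> * \<delta>\<close> and \<open>\<rho>\<^sup>2 * \<delta>\<close>.\<close>

lemma moment_lower_bound:
  fixes v w t0 t1 t2 :: int and d1 d2 d3 :: real
  assumes v: "0 \<le> v" "v \<le> b - a - 1" and w: "v * a \<le> w" "w \<le> (v + 1) * a - 1"
    and pos: "d1 > 0" "d2 > 0" "d3 > 0"
    and t: "of_int t0 = d1 + d2 + d3" "of_int t1 = r1 * d1 + r2 * d2 + r3 * d3"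
      "of_int t2 = r1\<^sup>2 * d1 + r2\<^sup>2 * d2 + r3\<^sup>2 * d3"
  shows "min (b - a - v + 1) (w - a * v + 1) \<le> - v * t0 + (b * w + 1) * t1 - w * t2"
proof -
  \<comment> \<open>The formula for \<open>p\<close> is
    \<open>\<eta> = \<rho> * (b - \<rho>)\<close> under the trace; the one for \<open>q\<close>
    comes from \<open>\<rho> * \<eta> = a * \<eta> - 1\<close>.\<close>
  define u p q where upq: "u = w - v * a" "p = b * t1 - t2" "q = a * p - t0"
  have u: "0 \<le> u" "u \<le> a - 1" using w by (auto simp: upq algebra_simps)
  have total: "- v * t0 + (b * w + 1) * t1 - w * t2 = t1 + u * p + v * q"
    by (simp add: upq algebra_simps)
  \<comment> \<open>\<open>y\<^sub>i = d\<^sub>i / \<bar>a - r\<^sub>i\<bar>\<close>, because \<open>r\<^sub>i * (b - r\<^sub>i) = 1 / (a - r\<^sub>i)\<close>\<close>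
  define y1 y2 y3 where y: "y1 = r1 * (b - r1) * d1" "y2 = r2 * (b - r2) * d2"
    "y3 = r3 * (r3 - b) * d3"
  have y_pos: "y1 > 0" "y2 > 0" "y3 > 0"
    unfolding y using pos r1 r2 r3 a ab by (auto intro!: mult_pos_pos)
  have d: "d1 = (a - r1) * y1" "d2 = (a - r2) * y2" "d3 = (r3 - a) * y3"
    using root_unit[of r1] root_unit[of r2] root_unit[of r3] unfolding y by (simp, algebra)+
  have p: "of_int p = y1 + y2 - y3"
    unfolding upq of_int_diff of_int_mult t y by (simp add: algebra_simps power2_eq_square)
  have t0: "of_int t0 = (a - r1) * y1 + (a - r2) * y2 + (r3 - a) * y3"
    unfolding t(1) d ..
  have q: "of_int q = r1 * y1 + r2 * y2 - r3 * y3"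
    unfolding upq(3) of_int_diff of_int_mult p t0 by (simp add: algebra_simps)
  have t1: "of_int t1 = r1 * (a - r1) * y1 + r2 * (a - r2) * y2 + r3 * (r3 - a) * y3"
    unfolding t(2) d by simp
  have "real_of_int t0 > 0" "real_of_int t1 > 0"
    unfolding t using pos r1 r2 r3 a ab by (auto intro!: add_pos_pos mult_pos_pos)
  then have "t0 \<ge> 1" "t1 \<ge> 1" by linarith+
  show ?thesis
  proof (cases "q \<ge> 0")
    case True
    then have "a * p > 0" using \<open>t0 \<ge> 1\<close> by (simp add: upq(3))
    then have "p \<ge> 1" using a by (simp add: zero_less_mult_iff)
    then have "u * 1 \<le> u * p" using u by (intro mult_left_mono) auto
    moreover have "v * q \<ge> 0" using True v by simp
    ultimately show ?thesis using \<open>t1 \<ge> 1\<close> unfolding total upq(1) by (simp add: mult.commute)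
  next
    case False
    define m where "m = b - a - v"
    have m: "m \<ge> 1" using v by (simp add: m_def)
    have "real_of_int q \<le> -1" using False by linarith
    moreover have "r1 * y1 > 0" "r2 * y2 > 0" using y_pos r1 r2 a by auto
    ultimately have ry3: "r3 * y3 \<ge> 1" using q by linarith
    have "t1 + u * p + v * q \<ge> m + 1"
    proof (cases "p \<ge> 0")
      case True
      have "of_int m < (r3 - a - v) * 1" using r3 by (simp add: m_def)
      also have "\<dots> \<le> (r3 - a - v) * (r3 * y3)"
        using ry3 r3 m by (intro mult_left_mono) (auto simp: m_def)
      also have "\<dots> \<le> (r1 * (a - r1) + v * r1) * y1 + (r2 * (a - r2) + v * r2) * y2 + \<dots>"
        using y_pos r1 r2 a v
        by (intro le_add_same_cancel2[THEN iffD2] add_nonneg_nonneg mult_nonneg_nonneg) auto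
      also have "\<dots> = real_of_int (t1 + v * q)"
        by (simp add: t1 q algebra_simps)
      finally have "m < t1 + v * q" by (simp only: of_int_less_iff)
      moreover have "u * p \<ge> 0" using True u by simp
      ultimately show ?thesis by linarith
    next
      case False
      then have "real_of_int p \<le> -1" by linarith
      then have y3: "y3 \<ge> 1" using p y_pos by linarith
      \<comment> \<open>Now \<open>y3 \<ge> 1\<close>, so it suffices that its factor
        \<open>r3 * (r3 - a - v) - u\<close> is at least \<open>m + 1\<close>. It is at least
        \<open>b * m - u\<close>, where \<open>(b - 1) * (m - 1) \<ge> 0\<close> and
        \<open>u \<le> a - 1\<close> give the bound.\<close>
      have "b * m \<ge> b + (m - 1)"
        using mult_nonneg_nonneg[of "b - 1" "m - 1"] a ab m by (simp add: algebra_simps)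
      then have "m + 1 \<le> b * m - u" using u ab by linarith
      then have "real_of_int (m + 1) \<le> of_int b * of_int m - of_int u"
        by (metis of_int_diff of_int_le_iff of_int_mult)
      also have "\<dots> \<le> r3 * (r3 - a - v) - u"
        using r3 m a ab by (intro diff_right_mono mult_mono) (auto simp: m_def)
      finally have c: "real_of_int (m + 1) \<le> r3 * (r3 - a - v) - u" .
      have "of_int (m + 1) \<le> (r3 * (r3 - a - v) - u) * 1" using c by simp
      also have "\<dots> \<le> (r3 * (r3 - a - v) - u) * y3"
        using c m y3 by (intro mult_left_mono) auto
      also have "\<dots> \<le> (r1 * (a - r1) + u + v * r1) * y1 + (r2 * (a - r2) + u + v * r2) * y2 + \<dots>"
        using y_pos r1 r2 a v u
        by (intro le_add_same_cancel2[THEN iffD2] add_nonneg_nonneg mult_nonneg_nonneg) auto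
      also have "\<dots> = real_of_int (t1 + u * p + v * q)"
        by (simp add: t1 p q algebra_simps)
      finally show ?thesis by (simp only: of_int_le_iff)
    qed
    then show ?thesis unfolding total m_def by simp
  qed
qed

lemma trace_lower_bound:
  fixes \<rho> :: complex and v w :: int
  assumes \<rho>: "rat_eval f \<rho> = 0"
    and v: "0 \<le> v" "v \<le> b - a - 1" and w: "v * a \<le> w" "w \<le> (v + 1) * a - 1"
    and \<delta>: "\<delta> \<in> codifferent_pos (rat_adjoin \<rho>) (int_adjoin \<rho>)"
  shows "of_int (min (b - a - v + 1) (w - a * v + 1)) \<le>
    field_trace (rat_adjoin \<rho>) ((- of_int v + of_int (b * w + 1) * \<rho> - of_int w * \<rho>\<^sup>2) * \<delta>)"
proof -
  from \<delta> have "\<delta> \<in> rat_adjoin \<rho>" by (simp add: codifferent_pos_def codifferent_def)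
  then obtain h where h: "\<delta> = rat_eval h \<rho>"
    unfolding rat_adjoin_eq_range[OF irreducible_f \<rho>] by blast
  have pos: "rat_eval h r1 > 0" "rat_eval h r2 > 0" "rat_eval h r3 > 0"
    using \<delta> totally_positive_rat_eval_iff[OF irreducible_f \<rho>, of h]
    by (simp_all add: codifferent_pos_def h rat_eval_f_real)
  have tr: "of_rat (field_trace (rat_adjoin \<rho>) (rat_eval g \<rho> * \<delta>)) =
      rat_eval g r1 * rat_eval h r1 + rat_eval g r2 * rat_eval h r2 + rat_eval g r3 * rat_eval h r3"
    for g
    using field_trace_rat_eval[OF \<rho>, of "g * h"] by (simp add: h)
  have "field_trace (rat_adjoin \<rho>) (rat_eval (map_poly of_int g) \<rho> * \<delta>) \<in> \<int>" for g
    using \<delta> by (auto simp: codifferent_pos_def codifferent_def int_adjoin_def rat_eval_map_of_int)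
  then have "\<exists>t. field_trace (rat_adjoin \<rho>) (rat_eval (map_poly of_int g) \<rho> * \<delta>) = of_int t" for g
    by (auto elim: Ints_cases)
  then have "\<exists>t. real_of_int t = rat_eval (map_poly of_int g) r1 * rat_eval h r1 +
      rat_eval (map_poly of_int g) r2 * rat_eval h r2 + rat_eval (map_poly of_int g) r3 * rat_eval h r3" for g
    using tr[of "map_poly of_int g"] by (metis of_rat_of_int_eq)
  \<comment> \<open>Testing the codifferent condition on 1, \<rho> and its square gives the integers
    \<open>t0\<close>, \<open>t1\<close>, \<open>t2\<close>.\<close>
  from this[of 1] this[of "[:0, 1:]"] this[of "[:0, 0, 1:]"]
  obtain t0 t1 t2 where t: "real_of_int t0 = rat_eval h r1 + rat_eval h r2 + rat_eval h r3"
    "real_of_int t1 = r1 * rat_eval h r1 + r2 * rat_eval h r2 + r3 * rat_eval h r3"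
    "real_of_int t2 = r1\<^sup>2 * rat_eval h r1 + r2\<^sup>2 * rat_eval h r2 + r3\<^sup>2 * rat_eval h r3"
    by (auto simp: map_poly_pCons power2_eq_square)
  define g :: "rat poly" where "g = [:- of_int v, of_int (b * w + 1), - of_int w:]"
  have g: "rat_eval g x = - of_int v + of_int (b * w + 1) * x - of_int w * x\<^sup>2"
    for x :: "'c::field_char_0"
    by (simp add: g_def of_rat_minus of_rat_add of_rat_mult algebra_simps power2_eq_square)
  have "of_rat (field_trace (rat_adjoin \<rho>) (rat_eval g \<rho> * \<delta>)) =
      real_of_int (- v * t0 + (b * w + 1) * t1 - w * t2)"
    by (subst tr) (simp add: g t algebra_simps)
  then have "field_trace (rat_adjoin \<rho>) (rat_eval g \<rho> * \<delta>) =
      of_int (- v * t0 + (b * w + 1) * t1 - w * t2)"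
    by (metis of_rat_of_int_eq of_rat_eq_iff)
  then show ?thesis
    using moment_lower_bound[OF v w pos t] unfolding g by (simp only: of_int_le_iff)
qed

section \<open>Elements attaining the two values\<close>

text \<open>Reducing \<alpha> times \<open>g\<close> modulo the cubic to a quadratic leaves all
  values at the roots unchanged, so by Euler's formula the trace is its leading coefficient
  \<open>z\<close>.\<close>

lemma trace_attained:
  fixes \<rho> :: complex and v w x y z :: int
  assumes \<rho>: "rat_eval f \<rho> = 0"
    and g: "poly (map_poly of_int g) r1 > (0 :: real)" "poly (map_poly of_int g) r2 < (0 :: real)"
      "poly (map_poly of_int g) r3 > (0 :: real)"
    and eq: "\<And>r :: real. r \<in> {r1, r2, r3} \<Longrightarrow>
      (- v + (b * w + 1) * r - w * r\<^sup>2) * poly (map_poly of_int g) r = x + y * r + z * r\<^sup>2"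
  shows "of_int z \<in> (\<lambda>\<delta>. field_trace (rat_adjoin \<rho>)
      ((- of_int v + of_int (b * w + 1) * \<rho> - of_int w * \<rho>\<^sup>2) * \<delta>)) `
    codifferent_pos (rat_adjoin \<rho>) (int_adjoin \<rho>)"
proof -
  obtain \<delta> where \<delta>: "\<delta> \<in> codifferent_pos (rat_adjoin \<rho>) (int_adjoin \<rho>)"
    "\<And>h. of_rat (field_trace (rat_adjoin \<rho>) (poly (map_poly of_int h) \<rho> * \<delta>)) = dual_sum (h * g)"
    using ex_codifferent_pos[OF \<rho> g] by metis
  have eval: "poly (map_poly of_int [:- v, b * w + 1, - w:]) r =
      - of_int v + of_int (b * w + 1) * r - of_int w * r\<^sup>2" for r :: "'c::comm_ring_1"
    by (simp add: map_poly_pCons algebra_simps power2_eq_square)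
  have "poly (map_poly of_int ([:- v, b * w + 1, - w:] * g)) r = poly (map_poly of_int [:x, y, z:]) r"
    if "r \<in> {r1, r2, r3}" for r
    using eq[OF that] unfolding of_int_poly_mult poly_mult eval
    by (simp add: map_poly_pCons algebra_simps power2_eq_square)
  then have "dual_sum ([:- v, b * w + 1, - w:] * g) = dual_sum [:x, y, z:]"
    by (simp only: dual_sum_def insertI1 insertI2)
  then have "of_rat (field_trace (rat_adjoin \<rho>)
      (poly (map_poly of_int [:- v, b * w + 1, - w:]) \<rho> * \<delta>)) = real_of_int z"
    by (simp only: \<delta>(2) dual_sum_quadratic)
  then have "field_trace (rat_adjoin \<rho>)
      (poly (map_poly of_int [:- v, b * w + 1, - w:]) \<rho> * \<delta>) = of_int z"
    by (metis of_rat_of_int_eq of_rat_eq_iff)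
  then show ?thesis
    using \<delta>(1) unfolding eval by (metis image_eqI)
qed

lemma trace_attained_left:
  fixes \<rho> :: complex and v w :: int
  assumes \<rho>: "rat_eval f \<rho> = 0"
  shows "of_int (b - a - v + 1) \<in> (\<lambda>\<delta>. field_trace (rat_adjoin \<rho>)
      ((- of_int v + of_int (b * w + 1) * \<rho> - of_int w * \<rho>\<^sup>2) * \<delta>)) `
    codifferent_pos (rat_adjoin \<rho>) (int_adjoin \<rho>)"
proof (rule trace_attained[OF \<rho>])
  \<comment> \<open>\<open>\<delta> = g(\<rho>) / f'(\<rho>)\<close> is the dual element with \<open>Tr(\<delta>) = 1\<close>, \<open>Tr(\<rho>\<delta>) = b - a + 1\<close>, \<open>Tr(\<rho>\<^sup>2\<delta>) = b (b - a + 1)\<close>.\<close>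
  let ?g = "[:a * (a - 1), 1 - 2 * a, 1:]"
  \<comment> \<open>This product is negative exactly between \<open>a - 1\<close> and
    \<open>a\<close>, an interval containing \<open>r2\<close> but neither \<open>r1\<close> nor
    \<open>r3\<close>.\<close>
  have g: "poly (map_poly of_int ?g) r = (r - a) * (r - a + 1)" for r :: real
    by (simp add: map_poly_pCons algebra_simps)
  show "poly (map_poly of_int ?g) r1 > (0 :: real)"
    unfolding g using r1 a by (intro mult_neg_neg) auto
  show "poly (map_poly of_int ?g) r2 < (0 :: real)"
    unfolding g using r2 by (intro mult_neg_pos) auto
  show "poly (map_poly of_int ?g) r3 > (0 :: real)"
    unfolding g using r3 ab by (intro mult_pos_pos) auto
  fix r :: real assume "r \<in> {r1, r2, r3}"
  then have "r * (r - a) * (r - b) = 1" by (rule root_unit)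
  then show "(- v + (b * w + 1) * r - w * r\<^sup>2) * poly (map_poly of_int ?g) r =
      (1 - v * a * (a - 1) + w * (a - 1)) +
      (- (a * b) + a * (a - 1) + v * (2 * a - 1) - w) * r + (b - a - v + 1) * r\<^sup>2"
    unfolding g by (simp only: of_int_add of_int_diff of_int_minus of_int_mult of_int_1 of_int_numeral) algebra
qed

lemma trace_attained_right:
  fixes \<rho> :: complex and v w :: int
  assumes \<rho>: "rat_eval f \<rho> = 0"
  shows "of_int (w - a * v + 1) \<in> (\<lambda>\<delta>. field_trace (rat_adjoin \<rho>)
      ((- of_int v + of_int (b * w + 1) * \<rho> - of_int w * \<rho>\<^sup>2) * \<delta>)) `
    codifferent_pos (rat_adjoin \<rho>) (int_adjoin \<rho>)"
proof (rule trace_attained[OF \<rho>])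
  \<comment> \<open>\<open>\<delta> = g(\<rho>) / f'(\<rho>)\<close> is the dual element with \<open>Tr(\<delta>) = a\<close>, \<open>Tr(\<rho>\<delta>) = 1\<close>, \<open>Tr(\<rho>\<^sup>2\<delta>) = b - 1\<close>.\<close>
  let ?g = "[:a * (a * b) - a - 1, 1 - a * (a + b), a:]"
  have g: "poly (map_poly of_int ?g) r = a * ((r - a) * (r - b)) + r - a - 1" for r :: real
    by (simp add: map_poly_pCons algebra_simps)
  \<comment> \<open>Multiplying by the positive root and using
    \<open>r * (r - a) * (r - b) = 1\<close> exposes the sign: negative exactly between 1 and
    \<open>a\<close>, where only \<open>r2\<close> lies.\<close>
  have rg: "r * poly (map_poly of_int ?g) r = (r - 1) * (r - a)" if "r \<in> {r1, r2, r3}" for r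
    unfolding g using root_unit[OF that] by algebra
  have "r1 * poly (map_poly of_int ?g) r1 > 0"
    unfolding rg[of r1, simplified] using r1 a by (intro mult_neg_neg) auto
  then show "poly (map_poly of_int ?g) r1 > (0 :: real)"
    using r1 by (simp add: zero_less_mult_iff)
  have "r2 * poly (map_poly of_int ?g) r2 < 0"
    unfolding rg[of r2, simplified] using r2 a by (intro mult_pos_neg) auto
  then show "poly (map_poly of_int ?g) r2 < (0 :: real)"
    using r2 a by (simp add: mult_less_0_iff)
  have "r3 * poly (map_poly of_int ?g) r3 > 0"
    unfolding rg[of r3, simplified] using r3 a ab by (intro mult_pos_pos) auto
  then show "poly (map_poly of_int ?g) r3 > (0 :: real)"
    using r3 a ab by (simp add: zero_less_mult_iff)
  fix r :: real assume "r \<in> {r1, r2, r3}"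
  then have "r * (r - a) * (r - b) = 1" by (rule root_unit)
  then show "(- v + (b * w + 1) * r - w * r\<^sup>2) * poly (map_poly of_int ?g) r =
      (w * (a * b - 1) + a - v * (a * (a * b) - a - 1)) +
      (- w * (a + b) - a - 1 - v * (1 - a * (a + b))) * r + (w - a * v + 1) * r\<^sup>2"
    unfolding g by (simp only: of_int_add of_int_diff of_int_minus of_int_mult of_int_1 of_int_numeral) algebra
qed

end

section \<open>Separation of the real roots and conclusion\<close>

text \<open>The cubic is -1 at 0, \<open>a\<close> and \<open>b\<close>, and positive at 1,
  \<open>a - 1\<close> and \<open>b + 1\<close>, so the intermediate value theorem gives one root in
  each interval.\<close>

lemma ex_cubic_roots:
  fixes a b :: int
  assumes "2 \<le> a" "a \<le> b - 2"
  shows "\<exists>r1 r2 r3. cubic_roots a b r1 r2 r3"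
proof -
  define F where "F x = x * (x - a) * (x - b) - 1" for x :: real
  have cont: "continuous_on A F" for A
    unfolding F_def by (intro continuous_intros)
  have a: "real_of_int a \<ge> 2" and ab: "real_of_int a \<le> b - 2" using assms by linarith+
  have F1: "F 1 > 0"
  proof -
    have "(real_of_int a - 1) * (b - 1) \<ge> 1 * 3" using a ab by (intro mult_mono) auto
    then show ?thesis by (simp add: F_def algebra_simps)
  qed
  have Fa1: "F (a - 1) > 0"
  proof -
    have "(real_of_int a - 1) * (b - a + 1) \<ge> 1 * 3" using a ab by (intro mult_mono) auto
    then show ?thesis by (simp add: F_def algebra_simps)
  qed
  have Fb1: "F (b + 1) > 0"
  proof -
    have "(real_of_int b + 1) * (b + 1 - a) \<ge> 5 * 3" using a ab by (intro mult_mono) auto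
    then show ?thesis by (simp add: F_def algebra_simps)
  qed
  have neg: "F 0 < 0" "F a < 0" "F b < 0" by (simp_all add: F_def)
  obtain r1 :: real where r1: "0 \<le> r1" "r1 \<le> 1" "F r1 = 0"
    using IVT'[of F 0 0 1] cont neg F1 by auto
  obtain r2 :: real where r2: "a - 1 \<le> r2" "r2 \<le> a" "F r2 = 0"
    using IVT2'[of F a 0 "a - 1"] cont neg Fa1 by auto
  obtain r3 :: real where r3: "b \<le> r3" "F r3 = 0"
    using IVT'[of F b 0 "b + 1"] cont neg Fb1 by auto
  have strict: "0 < r1" "r1 < 1" "a - 1 < r2" "r2 < a" "b < r3"
    using r1 r2 r3 neg F1 Fa1 by (auto simp: less_le)
  have distinct: "r1 \<noteq> r2" "r1 \<noteq> r3" "r2 \<noteq> r3" using strict a ab by auto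
  have "x ^ 3 - (real_of_int a + b) * x\<^sup>2 + real_of_int a * b * x - 1 = 0" if "x \<in> {r1, r2, r3}" for x
  proof -
    have "F x = 0" using that r1 r2 r3 by auto
    then show ?thesis unfolding F_def by algebra
  qed
  note Vieta = cubic_Vieta[OF distinct this]
  have "cubic_roots a b r1 r2 r3"
    using assms strict Vieta by unfold_locales auto
  then show ?thesis by blast
qed

theorem proposition5p4:
  fixes a b v w :: int and \<rho> \<alpha> :: complex
  assumes "2 \<le> a" and "a \<le> b - 2"
    and "poly (map_poly of_int [:-1, a * b, - (a + b), 1:]) \<rho> = 0"
    and "0 \<le> v" and "v \<le> b - a - 1"
    and "v * a \<le> w" and "w \<le> (v + 1) * a - 1"
    and "\<alpha> = - of_int v + of_int (b * w + 1) * \<rho> - of_int w * \<rho>\<^sup>2"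
  shows "is_minimum
    ((\<lambda>\<delta>. field_trace (rat_adjoin \<rho>) (\<alpha> * \<delta>)) ` codifferent_pos (rat_adjoin \<rho>) (int_adjoin \<rho>))
    (of_int (min (b - a - v + 1) (w - a * v + 1)))"
proof -
  obtain r1 r2 r3 where "cubic_roots a b r1 r2 r3"
    using ex_cubic_roots[OF assms(1,2)] by blast
  then interpret cubic_roots a b r1 r2 r3 .
  have \<rho>: "rat_eval f \<rho> = 0"
    using assms(3) unfolding f_def rat_eval_map_of_int .
  \<comment> \<open>Both numbers occur as traces, so their minimum does, whichever of the two is
    smaller.\<close>
  have "of_int (min (b - a - v + 1) (w - a * v + 1)) \<in>
    (\<lambda>\<delta>. field_trace (rat_adjoin \<rho>) (\<alpha> * \<delta>)) ` codifferent_pos (rat_adjoin \<rho>) (int_adjoin \<rho>)"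
    unfolding assms(8) min_def using trace_attained_left[OF \<rho>] trace_attained_right[OF \<rho>] by presburger
  then show ?thesis
    unfolding is_minimum_def assms(8) using trace_lower_bound[OF \<rho> assms(4-7)] by blast
qed

end
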